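(* Let $m,n\ge 1$ be integers, $r=\min(m,n)$, $\Omega\subset\{1,\dots,m\}\times\{1,\dots,n\}$, $X\in\mathbb{R}^{m\times n}$, $\lambda>0$ and $\sigma^2>0$. Let $s$ be the optimal value of the problem (P1) $$\min_{Z\in\mathbb{R}^{m\times n}}\ \frac{1}{2\sigma^2}\left\lVert P_\Omega(X-Z)\right\rVert_F^2+\lambda\lVert Z\rVert_*$$ (equivalently, of its rewriting (P1$'$) in terms of the singular value decomposition of $Z$), and let $t$ be the optimal value of the problem (P2) $$\min_{\vec d,\,\boldsymbol{\alpha},\,\boldsymbol{\beta}}\ \frac{1}{2\sigma^2}\left\lVert P_\Omega\Big(X-\sum_{k=1}^r d_k\boldsymbol{\alpha}_k\boldsymbol{\beta}_k^{\top}\Big)\right\rVert_F^2+\lambda\sum_{k=1}^r d_k$$ $$\text{s.t.}\quad d_k\ge 0,\quad \lVert\boldsymbol{\alpha}_k\rVert_2\le 1,\quad \lVert\boldsymbol{\beta}_k\rVert_2\le 1,\quad \text{for all } k\in\{1,\dots,r\},$$ where $\vec d=(d_1,\dots,d_r)\in\mathbb{R}^r$, $\boldsymbol{\alpha}=(\boldsymbol{\alpha}_1,\dots,\boldsymbol{\alpha}_r)$ with $\boldsymbol{\alpha}_k\in\mathbb{R}^m$, and $\boldsymbol{\beta}=(\boldsymbol{\beta}_1,\dots,\boldsymbol{\beta}_r)$ with $\boldsymbol{\beta}_k\in\mathbb{R}^n$. Then $s=t$. Furthermore, if $(\vec d^{\,*},\boldsymbol{\alpha}^*,\boldsymbol{\beta}^*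 )$ is an optimal solution of (P2), then $Z^*=\sum_{k=1}^r d_k^*\boldsymbol{\alpha}_k^*(\boldsymbol{\beta}_k^* )^{\top}$ is an optimal solution of (P1). Similarly, for any optimal solution $Z^\dagger$ of (P1), there exists a decomposition $Z^\dagger=\sum_{k=1}^r d_k^\dagger\boldsymbol{\alpha}_k^\dagger(\boldsymbol{\beta}_k^\dagger)^{\top}$ such that $(\vec d^{\,\dagger},\boldsymbol{\alpha}^\dagger,\boldsymbol{\beta}^\dagger)$ is an optimal solution of (P2).
   Context: For $A=(a_{ij})\in\mathbb{R}^{m\times n}$, $P_\Omega(A)$ is the $m\times n$ matrix that retains the entries $a_{ij}$ with $(i,j)\in\Omega$ and has all other entries replaced by $0$; thus $\lVert P_\Omega(A)\rVert_F^2=\sum_{(i,j)\in\Omega}a_{ij}^2$. $\lVert Z\rVert_*$ is the nuclear norm of $Z$, i.e. the sum of its singular values. Problem (P1$'$) is the equivalent rewriting of (P1): with $r=\min(m,n)$, minimize $\frac{1}{2\sigma^2}\lVert P_\Omega(X-\sum_{k=1}^r d_k\mathbf{u}_k\mathbf{v}_k^{\top})\rVert_F^2+\lambda\sum_{k=1}^r d_k$ over $d_k\in\mathbb{R}$, $\mathbf{u}_k\in\mathbb{R}^m$, $\mathbf{v}_k\in\mathbb{R}^n$ ($k=1,\dots,r$) subject to $d_k\ge 0$, $\lVert\mathbf{u}_k\rVert=\lVert\mathbf{v}_k\rVert=1$ for all $k$, and $\mathbf{u}_i^{\top}\mathbf{u}_j=0$, $\mathbf{v}_i^{\top}\mathbf{v}_j=0$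 for all $i\ne j$. *)

theory Defs
  imports "HOL-Analysis.Analysis"
begin

text \<open>An \<open>m \<times> n\<close> real matrix is an element of \<open>real ^ 'n ^ 'm\<close>; its library \<open>norm\<close> is the
  Frobenius norm.\<close>

lemma norm_matrix_sq: "(norm (A :: real ^ 'n ^ 'm))\<^sup>2 = (\<Sum>i\<in>UNIV. \<Sum>j\<in>UNIV. (A $ i $ j)\<^sup>2)"
  by (simp add: norm_vec_def L2_set_def sum_nonneg)

definition mask :: "('m \<times> 'n) set \<Rightarrow> real ^ 'n ^ 'm \<Rightarrow> real ^ 'n ^ 'm"
  where "mask \<Omega> A = (\<chi> i j. if (i, j) \<in> \<Omega> then A $ i $ j else 0)"

definition outer_prod :: "real ^ 'm \<Rightarrow> real ^ 'n \<Rightarrow> real ^ 'n ^ 'm"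
  where "outer_prod a b = (\<chi> i j. a $ i * b $ j)"

text \<open>The singular values of \<open>Z\<close> are the nonnegative square roots of the eigenvalues of the Gram
  matrix of \<open>Z\<close>, counted with the multiplicity of the eigenvalue. That matrix is symmetric, so the
  geometric multiplicity used here is also the algebraic one. If \<open>n > m\<close>, it has \<open>n - m\<close> more
  zero eigenvalues than \<open>Z\<close> has zero singular values in the convention with \<open>min m n\<close> of them; this
  does not affect the sum.\<close>

definition right_singular_space :: "real ^ 'n ^ 'm \<Rightarrow> real \<Rightarrow> (real ^ 'n) set"
  where "right_singular_space Z s = {v. (transpose Z ** Z) *v v = s\<^sup>2 *\<^sub>R v}"

definition singular_values :: "real ^ 'n ^ 'm \<Rightarrow> real set"
  where "singular_values Z = {s. 0 \<le> s \<and> (\<exists>v\<in>right_singular_space Z s. v \<noteq> 0)}"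

definition nuclear_norm :: "real ^ 'n ^ 'm \<Rightarrow> real"
  where "nuclear_norm Z = (\<Sum>s\<in>singular_values Z. real (dim (right_singular_space Z s)) * s)"

lemma right_singular_space_orthogonal:
  fixes Z :: "real ^ 'n ^ 'm"
  assumes "v \<in> right_singular_space Z s" "w \<in> right_singular_space Z t" "s\<^sup>2 \<noteq> t\<^sup>2"
  shows "v \<bullet> w = 0"
proof -
  let ?G = "transpose Z ** Z"
  have "(?G *v v) \<bullet> w = v \<bullet> (?G *v w)"
    by (metis dot_lmul_matrix inner_commute matrix_transpose_mul transpose_matrix_vector
        transpose_transpose)
  then have "s\<^sup>2 * (v \<bullet> w) = t\<^sup>2 * (v \<bullet> w)"
    using assms(1,2) by (simp add: right_singular_space_def)
  then show ?thesis using assms(3) by simp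
qed

text \<open>The sum in the definition of the nuclear norm is over a finite set.\<close>

lemma finite_singular_values: "finite (singular_values Z)"
proof -
  define f where "f s = (SOME v. v \<in> right_singular_space Z s \<and> v \<noteq> 0)" for s
  have f: "f s \<in> right_singular_space Z s" "f s \<noteq> 0" if "s \<in> singular_values Z" for s
    using that someI_ex[of "\<lambda>v. v \<in> right_singular_space Z s \<and> v \<noteq> 0"]
    unfolding singular_values_def f_def by auto
  have orth: "f s \<bullet> f t = 0"
    if "s \<in> singular_values Z" "t \<in> singular_values Z" "s \<noteq> t" for s t
    by (rule right_singular_space_orthogonal[OF f(1) f(1)])
      (use that in \<open>auto simp: singular_values_def power2_eq_iff_nonneg\<close>)
  have "inj_on f (singular_values Z)"
    by (rule inj_onI) (metis f(2) inner_eq_zero_iff orth)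
  moreover have "pairwise orthogonal (f ` singular_values Z)"
    using orth by (auto simp: pairwise_def orthogonal_def)
  then have "finite (f ` singular_values Z)"
    using f(2) pairwise_orthogonal_imp_finite by blast
  ultimately show ?thesis by (simp add: finite_image_iff)
qed

definition P1_obj :: "('m \<times> 'n) set \<Rightarrow> real ^ 'n ^ 'm \<Rightarrow> real \<Rightarrow> real \<Rightarrow> real ^ 'n ^ 'm \<Rightarrow> real"
  where "P1_obj \<Omega> X lam \<sigma> Z =
    1 / (2 * \<sigma>\<^sup>2) * (norm (mask \<Omega> (X - Z)))\<^sup>2 + lam * nuclear_norm Z"

text \<open>A triple \<open>(d, \<alpha>, \<beta>)\<close> encodes the families \<open>d\<^sub>k, \<alpha>\<^sub>k, \<beta>\<^sub>k\<close> for \<open>1 \<le> k \<le> r\<close>. Values at other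
  indices are unconstrained and enter neither the objective nor the constraints.\<close>

type_synonym ('m, 'n) factors = "(nat \<Rightarrow> real) \<times> (nat \<Rightarrow> real ^ 'm) \<times> (nat \<Rightarrow> real ^ 'n)"

fun factor_sum :: "('m::finite, 'n::finite) factors \<Rightarrow> real ^ 'n ^ 'm"
  where "factor_sum (d, \<alpha>, \<beta>) =
    (\<Sum>k = 1..min CARD('m) CARD('n). d k *\<^sub>R outer_prod (\<alpha> k) (\<beta> k))"

fun P2_obj :: "('m::finite \<times> 'n::finite) set \<Rightarrow> real ^ 'n ^ 'm \<Rightarrow> real \<Rightarrow> real \<Rightarrow>
    ('m, 'n) factors \<Rightarrow> real"
  where "P2_obj \<Omega> X lam \<sigma> (d, \<alpha>, \<beta>) =
    1 / (2 * \<sigma>\<^sup>2) * (norm (mask \<Omega> (X - factor_sum (d, \<alpha>, \<beta>))))\<^sup>2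
      + lam * (\<Sum>k = 1..min CARD('m) CARD('n). d k)"

fun P2_feasible :: "('m::finite, 'n::finite) factors \<Rightarrow> bool"
  where "P2_feasible (d, \<alpha> :: nat \<Rightarrow> real ^ 'm, \<beta> :: nat \<Rightarrow> real ^ 'n) \<longleftrightarrow>
    (\<forall>k \<in> {1..min CARD('m) CARD('n)}. 0 \<le> d k \<and> norm (\<alpha> k) \<le> 1 \<and> norm (\<beta> k) \<le> 1)"

text \<open>Feasibility for the rewriting of the first problem in terms of the singular value
  decomposition; its objective is the same expression \<open>P2_obj\<close>.\<close>

fun P1'_feasible :: "('m::finite, 'n::finite) factors \<Rightarrow> bool"
  where "P1'_feasible (d, u :: nat \<Rightarrow> real ^ 'm, v :: nat \<Rightarrow> real ^ 'n) \<longleftrightarrow>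
    (\<forall>k \<in> {1..min CARD('m) CARD('n)}. 0 \<le> d k \<and> norm (u k) = 1 \<and> norm (v k) = 1) \<and>
    (\<forall>i \<in> {1..min CARD('m) CARD('n)}. \<forall>j \<in> {1..min CARD('m) CARD('n)}.
       i \<noteq> j \<longrightarrow> u i \<bullet> u j = 0 \<and> v i \<bullet> v j = 0)"

text \<open>\<open>Inf\<close> on reals is only specified for nonempty sets that are bounded below. The objectives above are
  nonnegative on their feasible sets when \<open>lam > 0\<close>, and the feasible sets are nonempty.\<close>

definition optimal_value :: "('a \<Rightarrow> real) \<Rightarrow> ('a \<Rightarrow> bool) \<Rightarrow> real"
  where "optimal_value f feasible = Inf (f ` {x. feasible x})"

end

theory Submission
  imports Defs
begin

text \<open>Choosing successively unit vectors \<open>u\<close>, \<open>v\<close> that maximize \<open>u \<bullet> (Z *v v)\<close> orthogonally to the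
  pairs already found gives a singular value decomposition \<open>Z = (\<Sum>k. d\<^sub>k u\<^sub>k v\<^sub>k\<^sup>T)\<close>, and for every such
  decomposition the nuclear norm is \<open>\<Sum>k. d\<^sub>k\<close>. If also \<open>Z = (\<Sum>j. c\<^sub>j a\<^sub>j b\<^sub>j\<^sup>T)\<close> with vectors in the unit
  balls, then \<open>(\<Sum>k. d\<^sub>k) = (\<Sum>k. u\<^sub>k \<bullet> (Z *v v\<^sub>k)) = (\<Sum>j. c\<^sub>j (\<Sum>k. (u\<^sub>k \<bullet> a\<^sub>j) (v\<^sub>k \<bullet> b\<^sub>j))) \<le> (\<Sum>j. c\<^sub>j)\<close> by
  the inequalities of Cauchy-Schwarz and Bessel. So \<open>nuclear_norm Z\<close> is the least value of \<open>\<Sum>j. c\<^sub>j\<close>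
  over all such representations of \<open>Z\<close>, and it is attained.\<close>

section \<open>Orthonormal families in inner product spaces\<close>

definition orthonormal_family :: "'k set \<Rightarrow> ('k \<Rightarrow> 'a::real_inner) \<Rightarrow> bool"
  where "orthonormal_family K u \<longleftrightarrow> (\<forall>i\<in>K. \<forall>j\<in>K. u i \<bullet> u j = (if i = j then 1 else 0))"

lemma orthonormal_familyD:
  "orthonormal_family K u \<Longrightarrow> i \<in> K \<Longrightarrow> j \<in> K \<Longrightarrow> u i \<bullet> u j = (if i = j then 1 else 0)"
  by (simp add: orthonormal_family_def)

lemma orthonormal_family_subset:
  "orthonormal_family K u \<Longrightarrow> J \<subseteq> K \<Longrightarrow> orthonormal_family J u"
  unfolding orthonormal_family_def by blast

lemma orthonormal_family_iff:
  "orthonormal_family K u \<longleftrightarrow>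
    (\<forall>i\<in>K. norm (u i) = 1) \<and> (\<forall>i\<in>K. \<forall>j\<in>K. i \<noteq> j \<longrightarrow> u i \<bullet> u j = 0)"
  by (auto simp: orthonormal_family_def norm_eq_1)

lemma orthonormal_family_inj_on:
  assumes "orthonormal_family K u"
  shows "inj_on u K"
  using assms unfolding orthonormal_family_def inj_on_def by (metis zero_neq_one)

lemma orthonormal_family_dim_span:
  fixes u :: "'k \<Rightarrow> 'a::euclidean_space"
  assumes "orthonormal_family K u"
  shows "dim (span (u ` K)) = card K"
proof -
  have "pairwise orthogonal (u ` K)" "0 \<notin> u ` K"
    using assms by (force simp: pairwise_def orthogonal_def orthonormal_family_iff)+
  then have "independent (u ` K)"
    by (rule pairwise_orthogonal_independent)
  then show ?thesis
    by (simp add: dim_eq_card_independent card_image orthonormal_family_inj_on[OF assms])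
qed

lemma orthonormal_family_inner_sum:
  assumes "orthonormal_family K u" "finite K" "i \<in> K"
  shows "u i \<bullet> (\<Sum>k\<in>K. c k *\<^sub>R u k) = c i"
proof -
  have "u i \<bullet> (\<Sum>k\<in>K. c k *\<^sub>R u k) = (\<Sum>k\<in>K. if i = k then c k else 0)"
    unfolding inner_sum_right
    by (intro sum.cong refl) (simp add: orthonormal_familyD[OF assms(1) assms(3)])
  also have "\<dots> = c i"
    using assms by simp
  finally show ?thesis .
qed

text \<open>The vector \<open>p\<close> is the orthogonal projection of \<open>x\<close> onto the
  span of the family. It satisfies \<open>p \<bullet> x = p \<bullet> p\<close>, so expanding the
  square of \<open>x - p\<close> leaves \<open>x \<bullet> x - p \<bullet> p\<close>, which is
  therefore nonnegative.\<close>

lemma bessel_inequality: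
  assumes "orthonormal_family K u" "finite K"
  shows "(\<Sum>k\<in>K. (u k \<bullet> x)\<^sup>2) \<le> (norm x)\<^sup>2"
proof -
  define p where "p = (\<Sum>k\<in>K. (u k \<bullet> x) *\<^sub>R u k)"
  have xp: "p \<bullet> x = (\<Sum>k\<in>K. (u k \<bullet> x)\<^sup>2)"
    by (simp add: p_def inner_sum_left power2_eq_square)
  have "p \<bullet> p = (\<Sum>k\<in>K. (u k \<bullet> x) * (u k \<bullet> p))"
    by (subst (1) p_def) (simp add: inner_sum_left)
  also have "\<dots> = (\<Sum>k\<in>K. (u k \<bullet> x)\<^sup>2)"
    unfolding p_def
    by (intro sum.cong refl) (simp add: orthonormal_family_inner_sum[OF assms] power2_eq_square)
  finally have pp: "p \<bullet> p = (\<Sum>k\<in>K. (u k \<bullet> x)\<^sup>2)" .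
  have "0 \<le> (x - p) \<bullet> (x - p)"
    by simp
  then show ?thesis
    using xp pp by (simp add: inner_diff inner_commute power2_norm_eq_inner)
qed

text \<open>The left side is the Frobenius inner product of the sum of the matrices
  \<open>outer_prod (u k) (v k)\<close> with \<open>outer_prod x y\<close>. The bound thus expresses
  that this sum has operator norm at most 1, the dual side of the nuclear norm.\<close>

lemma orthonormal_families_inner_bound:
  assumes "orthonormal_family K u" "orthonormal_family K v" "finite K"
  shows "(\<Sum>k\<in>K. (u k \<bullet> x) * (v k \<bullet> y)) \<le> norm x * norm y"
proof -
  have "(\<Sum>k\<in>K. (u k \<bullet> x) * (v k \<bullet> y)) \<le> (\<Sum>k\<in>K. \<bar>u k \<bullet> x\<bar> * \<bar>v k \<bullet> y\<bar>)"
    by (intro sum_mono) (metis abs_ge_self abs_mult)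
  also have "\<dots> \<le> L2_set (\<lambda>k. u k \<bullet> x) K * L2_set (\<lambda>k. v k \<bullet> y) K"
    by (rule L2_set_mult_ineq)
  also have "\<dots> \<le> norm x * norm y"
    by (intro mult_mono)
      (simp_all add: L2_set_def real_le_lsqrt bessel_inequality assms sum_nonneg)
  finally show ?thesis .
qed

lemma orthonormal_family_ex_orthogonal_unit:
  fixes u :: "'k \<Rightarrow> 'a::euclidean_space"
  assumes "finite K" "card K < DIM('a)"
  shows "\<exists>x. norm x = 1 \<and> (\<forall>k\<in>K. u k \<bullet> x = 0)"
proof -
  have "dim (u ` K) < DIM('a)"
    using assms by (meson card_image_le dim_le_card' finite_imageI le_less_trans order_trans)
  then obtain x where x: "x \<noteq> 0" "\<And>y. y \<in> span (u ` K) \<Longrightarrow> orthogonal x y"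
    using orthogonal_to_subspace_exists[of "u ` K"] by blast
  have "u k \<bullet> x = 0" if "k \<in> K" for k
    using x(2)[OF span_base] that by (metis image_eqI inner_commute orthogonal_def)
  then show ?thesis
    using x(1) by (intro exI[of _ "sgn x"]) (simp add: norm_sgn sgn_div_norm)
qed

section \<open>Rank-one matrices and their action on vectors\<close>

declare transpose_matrix_vector [simp del]

lemma inner_matrix_vector_mult:
  fixes Z :: "real ^ 'n ^ 'm"
  shows "u \<bullet> (Z *v x) = (transpose Z *v u) \<bullet> x"
  by (metis dot_lmul_matrix transpose_matrix_vector)

lemma outer_prod_mult_vec: "outer_prod a b *v x = (b \<bullet> x) *\<^sub>R a"
  by (simp add: outer_prod_def matrix_vector_mult_def vec_eq_iff inner_vec_def sum_distrib_left
      sum_distrib_right mult_ac)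

lemma sum_outer_prod_mult_vec:
  "(\<Sum>k\<in>K. d k *\<^sub>R outer_prod (a k) (b k)) *v x = (\<Sum>k\<in>K. (d k * (b k \<bullet> x)) *\<^sub>R a k)"
  by (induction K rule: infinite_finite_induct)
    (simp_all add: matrix_vector_mult_add_rdistrib outer_prod_mult_vec
      flip: scaleR_matrix_vector_assoc)

lemma transpose_sum_outer_prod:
  "transpose (\<Sum>k\<in>K. d k *\<^sub>R outer_prod (a k) (b k)) = (\<Sum>k\<in>K. d k *\<^sub>R outer_prod (b k) (a k))"
  by (simp add: vec_eq_iff transpose_def outer_prod_def mult.commute)

section \<open>Singular value decomposition\<close>

text \<open>A partial singular value decomposition: \<open>K\<close> may be too small for the
  triples to determine \<open>Z\<close>. Keeping the equations for both \<open>Z\<close> and its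
  transpose makes the notion symmetric under exchanging \<open>u\<close> and \<open>v\<close>, and
  makes the orthogonal complements of the chosen vectors invariant.\<close>

definition singular_triples ::
    "real ^ 'n ^ 'm \<Rightarrow> 'k set \<Rightarrow> ('k \<Rightarrow> real) \<Rightarrow> ('k \<Rightarrow> real ^ 'm) \<Rightarrow> ('k \<Rightarrow> real ^ 'n) \<Rightarrow> bool"
  where "singular_triples Z K d u v \<longleftrightarrow>
    orthonormal_family K u \<and> orthonormal_family K v \<and>
    (\<forall>k\<in>K. 0 \<le> d k \<and> Z *v v k = d k *\<^sub>R u k \<and> transpose Z *v u k = d k *\<^sub>R v k)"

lemma singular_triples_transpose:
  "singular_triples (transpose Z) K d v u \<longleftrightarrow> singular_triples Z K d u v"
  by (auto simp: singular_triples_def)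

text \<open>Among unit vectors, \<open>x \<bullet> w\<close> is largest in the direction of
  \<open>w\<close> itself, with value \<open>norm w\<close>. A unit vector \<open>u\<close> that
  does at least as well forces \<open>norm w \<le> c\<close>, and the equality case of
  Cauchy-Schwarz then gives \<open>w = c *\<^sub>R u\<close>.\<close>

lemma eq_scaleR_maximizer:
  fixes w u :: "'a::real_inner"
  assumes "norm u = 1" "u \<bullet> w = c" "0 \<le> c" "w \<noteq> 0 \<Longrightarrow> sgn w \<bullet> w \<le> c"
  shows "w = c *\<^sub>R u"
proof -
  have "norm w \<le> c"
  proof (cases "w = 0")
    case False
    have "sgn w \<bullet> w = norm w"
      using False by (simp add: sgn_div_norm power2_eq_square flip: power2_norm_eq_inner)
    then show ?thesis
      using assms(4) False by simp
  qed (simp add: assms(3))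
  then have "w \<bullet> w \<le> c\<^sup>2"
    by (metis norm_ge_zero power2_norm_eq_inner power_mono)
  moreover have "u \<bullet> u = 1"
    using assms(1) by (simp add: norm_eq_1)
  \<comment> \<open>Since \<open>u \<bullet> w = c\<close> and \<open>u \<bullet> u = 1\<close>, the
    square expands to \<open>w \<bullet> w - c\<^sup>2\<close>.\<close>
  ultimately have "(w - c *\<^sub>R u) \<bullet> (w - c *\<^sub>R u) \<le> 0"
    using assms(2) by (simp add: inner_diff inner_commute power2_eq_square)
  then show ?thesis
    by (metis eq_iff_diff_eq_0 inner_ge_zero inner_eq_zero_iff order_antisym)
qed

text \<open>The bilinear form attains its maximum at some \<open>(x, y)\<close> in the compact set
  \<open>S \<times> T\<close>. For \<open>i\<close> in \<open>K\<close>,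
  \<open>u i \<bullet> (Z *v y)\<close> equals \<open>d i * (v i \<bullet> y) = 0\<close>, so the
  normalized \<open>Z *v y\<close>, if nonzero, competes with \<open>x\<close> in \<open>S\<close>;
  maximality then makes \<open>Z *v y\<close> a multiple of \<open>x\<close>. The same argument for
  the transpose yields the second equation with the same constant \<open>c\<close>.\<close>

lemma singular_triples_extend:
  fixes Z :: "real ^ 'n ^ 'm"
  assumes st: "singular_triples Z K d u v" and K: "finite K" "k \<notin> K"
    and card: "card K < CARD('m)" "card K < CARD('n)"
  shows "\<exists>d u v. singular_triples Z (insert k K) d u v"
proof -
  define S where "S = {x. norm x = 1 \<and> (\<forall>i\<in>K. u i \<bullet> x = 0)}"
  define T where "T = {y. norm y = 1 \<and> (\<forall>i\<in>K. v i \<bullet> y = 0)}"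
  have uo: "orthonormal_family K u" and vo: "orthonormal_family K v"
    and Zv: "\<And>i. i \<in> K \<Longrightarrow> Z *v v i = d i *\<^sub>R u i"
    and Zu: "\<And>i. i \<in> K \<Longrightarrow> transpose Z *v u i = d i *\<^sub>R v i"
    and d0: "\<And>i. i \<in> K \<Longrightarrow> 0 \<le> d i"
    using st by (auto simp: singular_triples_def)
  have "S \<noteq> {}" "T \<noteq> {}"
    unfolding S_def T_def
    using orthonormal_family_ex_orthogonal_unit[of K u]
      orthonormal_family_ex_orthogonal_unit[of K v] K card by auto
  moreover have "compact S"
  proof -
    have "S = sphere 0 1 \<inter> (\<Inter>i\<in>K. {x. u i \<bullet> x = 0})"
      by (auto simp: S_def)
    then show ?thesis
      by (auto intro!: compact_Int_closed closed_INT closed_hyperplane)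
  qed
  moreover have "compact T"
  proof -
    have "T = sphere 0 1 \<inter> (\<Inter>i\<in>K. {x. v i \<bullet> x = 0})"
      by (auto simp: T_def)
    then show ?thesis
      by (auto intro!: compact_Int_closed closed_INT closed_hyperplane)
  qed
  ultimately have "compact (S \<times> T)" "S \<times> T \<noteq> {}"
    by (auto intro: compact_Times)
  moreover have "continuous_on (S \<times> T) (\<lambda>p. fst p \<bullet> (Z *v snd p))"
    by (intro continuous_intros continuous_on_fst continuous_on_snd
        continuous_on_compose2[OF matrix_vector_mult_linear_continuous_on[of UNIV Z]]) auto
  ultimately obtain p where "p \<in> S \<times> T"
    and p: "\<And>q. q \<in> S \<times> T \<Longrightarrow> fst q \<bullet> (Z *v snd q) \<le> fst p \<bullet> (Z *v snd p)"
    using continuous_attains_sup by meson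
  then obtain x y where x: "x \<in> S" and y: "y \<in> T"
    and max: "\<And>x' y'. x' \<in> S \<Longrightarrow> y' \<in> T \<Longrightarrow> x' \<bullet> (Z *v y') \<le> x \<bullet> (Z *v y)"
    by (cases p) force
  define c where "c = x \<bullet> (Z *v y)"
  \<comment> \<open>Flipping the sign of \<open>x\<close> stays in \<open>S\<close> and negates the
    form, so its maximum cannot be negative.\<close>
  have "- x \<in> S"
    using x by (simp add: S_def)
  then have c0: "0 \<le> c"
    using max[of "- x" y] y by (simp add: c_def)
  have Zy: "Z *v y = c *\<^sub>R x"
  proof (rule eq_scaleR_maximizer)
    assume nz: "Z *v y \<noteq> 0"
    have "u i \<bullet> (Z *v y) = 0" if "i \<in> K" for i
      using that y by (simp add: inner_matrix_vector_mult Zu T_def)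
    then have "sgn (Z *v y) \<in> S"
      using nz by (simp add: S_def norm_sgn sgn_div_norm)
    then show "sgn (Z *v y) \<bullet> (Z *v y) \<le> c"
      using max y by (simp add: c_def)
  qed (use x c0 in \<open>auto simp: S_def c_def\<close>)
  have adj: "z \<bullet> (transpose Z *v x) = x \<bullet> (Z *v z)" for z
    by (metis inner_commute inner_matrix_vector_mult)
  have Zx: "transpose Z *v x = c *\<^sub>R y"
  proof (rule eq_scaleR_maximizer)
    assume nz: "transpose Z *v x \<noteq> 0"
    have "v i \<bullet> (transpose Z *v x) = 0" if "i \<in> K" for i
      using that x by (simp add: inner_matrix_vector_mult Zv S_def)
    then have "sgn (transpose Z *v x) \<in> T"
      using nz by (simp add: T_def norm_sgn sgn_div_norm)
    then show "sgn (transpose Z *v x) \<bullet> (transpose Z *v x) \<le> c"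
      using max[OF x] by (simp add: c_def adj)
  qed (use y c0 in \<open>auto simp: T_def c_def adj\<close>)
  have "orthonormal_family (insert k K) (u(k := x))"
    using uo x K(2) by (auto simp: orthonormal_family_def S_def inner_commute norm_eq_1)
  moreover have "orthonormal_family (insert k K) (v(k := y))"
    using vo y K(2) by (auto simp: orthonormal_family_def T_def inner_commute norm_eq_1)
  ultimately have "singular_triples Z (insert k K) (d(k := c)) (u(k := x)) (v(k := y))"
    using K(2) c0 Zx Zy Zu Zv d0 by (auto simp: singular_triples_def)
  then show ?thesis
    by blast
qed

lemma singular_triples_exist:
  fixes Z :: "real ^ 'n ^ 'm"
  assumes "finite K" "card K \<le> CARD('m)" "card K \<le> CARD('n)"
  shows "\<exists>d u v. singular_triples Z K d u v"
  using assms
proof (induction K rule: finite_induct)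
  case empty
  then show ?case
    by (auto simp: singular_triples_def orthonormal_family_def)
next
  case (insert k K)
  then obtain d u v where "singular_triples Z K d u v"
    by auto
  then show ?case
    by (rule singular_triples_extend) (use insert in auto)
qed

text \<open>With \<open>CARD('n)\<close> indices the vectors \<open>v k\<close> span the whole
  domain, and both sides send \<open>v j\<close> to \<open>d j *\<^sub>R u j\<close>.\<close>

lemma singular_triples_decomposition_full:
  fixes Z :: "real ^ 'n ^ 'm"
  assumes st: "singular_triples Z K d u v" and K: "finite K" "card K = CARD('n)"
  shows "Z = (\<Sum>k\<in>K. d k *\<^sub>R outer_prod (u k) (v k))" (is "Z = ?W")
proof -
  have vo: "orthonormal_family K v"
    using st by (simp add: singular_triples_def)
  have "dim (span (v ` K)) = DIM(real ^ 'n)"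
    using orthonormal_family_dim_span[OF vo] K by simp
  then have span: "span (v ` K) = UNIV"
    by (simp only: dim_span dim_eq_full)
  have on_v: "Z *v b = ?W *v b" if b: "b \<in> v ` K" for b
  proof -
    obtain j where j: "j \<in> K" "b = v j"
      using b by blast
    have "?W *v v j = (\<Sum>k\<in>K. if j = k then d k *\<^sub>R u k else 0)"
      unfolding sum_outer_prod_mult_vec
      by (intro sum.cong refl) (simp add: orthonormal_familyD[OF vo _ j(1)])
    also have "\<dots> = Z *v v j"
      using st j K(1) by (simp add: singular_triples_def)
    finally show ?thesis
      using j by simp
  qed
  have "Z *v x = ?W *v x" for x
    by (rule linear_eq_on_span[of "(*v) Z" "(*v) ?W" "v ` K"]) (use on_v span in auto)
  then show ?thesis
    by (simp add: matrix_eq)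
qed

lemma singular_triples_decomposition:
  fixes Z :: "real ^ 'n ^ 'm"
  assumes st: "singular_triples Z K d u v" and K: "finite K" "card K = min CARD('m) CARD('n)"
  shows "Z = (\<Sum>k\<in>K. d k *\<^sub>R outer_prod (u k) (v k))"
proof (cases "CARD('n) \<le> CARD('m)")
  case True
  then show ?thesis
    using singular_triples_decomposition_full[OF st] K by simp
next
  case False
  \<comment> \<open>For a wide matrix it is the vectors \<open>u k\<close> that span their space, so
    the full case is applied to the transpose.\<close>
  then have "transpose Z = (\<Sum>k\<in>K. d k *\<^sub>R outer_prod (v k) (u k))"
    using singular_triples_decomposition_full[of "transpose Z" K d v u] K st
    by (simp add: singular_triples_transpose)
  then have "transpose (transpose Z) = transpose (\<Sum>k\<in>K. d k *\<^sub>R outer_prod (v k) (u k))"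
    by (rule arg_cong)
  then show ?thesis
    by (simp only: transpose_sum_outer_prod transpose_transpose)
qed

section \<open>The nuclear norm and rank-one decompositions\<close>

lemma nuclear_norm_nonneg: "0 \<le> nuclear_norm Z"
  by (auto simp: nuclear_norm_def singular_values_def intro!: sum_nonneg)

text \<open>The Gram matrix acts diagonally on the family \<open>v\<close>, with eigenvalues
  \<open>(d k)\<^sup>2\<close>. The value \<open>s = 0\<close> is excluded because its eigenspace
  also contains everything orthogonal to all \<open>v k\<close>.\<close>

lemma right_singular_space_sum_outer_prod:
  fixes u :: "'k \<Rightarrow> real ^ 'm" and v :: "'k \<Rightarrow> real ^ 'n"
  assumes uo: "orthonormal_family K u" and vo: "orthonormal_family K v" and K: "finite K"
    and d: "\<And>k. k \<in> K \<Longrightarrow> 0 \<le> d k" and s: "0 < s"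
  shows "right_singular_space (\<Sum>k\<in>K. d k *\<^sub>R outer_prod (u k) (v k)) s =
    span (v ` {k \<in> K. d k = s})" (is "right_singular_space ?Z s = span (v ` ?J)")
proof -
  have gram: "(transpose ?Z ** ?Z) *v x = (\<Sum>k\<in>K. ((d k)\<^sup>2 * (v k \<bullet> x)) *\<^sub>R v k)" for x
  proof -
    have "(transpose ?Z ** ?Z) *v x =
        (\<Sum>k\<in>K. (d k * (u k \<bullet> (\<Sum>j\<in>K. (d j * (v j \<bullet> x)) *\<^sub>R u j))) *\<^sub>R v k)"
      by (simp only: transpose_sum_outer_prod sum_outer_prod_mult_vec
          flip: matrix_vector_mul_assoc)
    also have "\<dots> = (\<Sum>k\<in>K. ((d k)\<^sup>2 * (v k \<bullet> x)) *\<^sub>R v k)"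
      by (intro sum.cong refl)
        (simp add: orthonormal_family_inner_sum[OF uo K] power2_eq_square)
    finally show ?thesis .
  qed
  show ?thesis
  proof (intro equalityI subsetI)
    fix x
    assume "x \<in> right_singular_space ?Z s"
    then have x: "(\<Sum>k\<in>K. ((d k)\<^sup>2 * (v k \<bullet> x)) *\<^sub>R v k) = s\<^sup>2 *\<^sub>R x"
      by (simp only: right_singular_space_def mem_Collect_eq gram)
    have coord: "v k \<bullet> x = 0" if "k \<in> K" "d k \<noteq> s" for k
    proof -
      \<comment> \<open>The eigenvector equation is compared in the coordinate along
        \<open>v k\<close>.\<close>
      have "s\<^sup>2 * (v k \<bullet> x) = (d k)\<^sup>2 * (v k \<bullet> x)"
        using orthonormal_family_inner_sum[OF vo K that(1), of "\<lambda>k. (d k)\<^sup>2 * (v k \<bullet> x)"]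
        by (simp only: x inner_scaleR_right)
      moreover have "(d k)\<^sup>2 \<noteq> s\<^sup>2"
        using that d s by (simp add: power2_eq_iff_nonneg)
      ultimately show ?thesis
        by simp
    qed
    have "(\<Sum>k\<in>K. ((d k)\<^sup>2 * (v k \<bullet> x)) *\<^sub>R v k) \<in> span (v ` ?J)"
    proof (rule span_sum)
      fix k assume "k \<in> K"
      then show "((d k)\<^sup>2 * (v k \<bullet> x)) *\<^sub>R v k \<in> span (v ` ?J)"
        by (cases "d k = s") (auto simp: coord span_0 intro!: span_scale span_base[OF imageI])
    qed
    then have "(1 / s\<^sup>2) *\<^sub>R (s\<^sup>2 *\<^sub>R x) \<in> span (v ` ?J)"
      unfolding x by (rule span_scale)
    then show "x \<in> span (v ` ?J)"
      using s by simp
  next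
    fix x
    assume "x \<in> span (v ` ?J)"
    moreover have "subspace (right_singular_space ?Z s)"
      by (auto simp: right_singular_space_def subspace_def matrix_vector_right_distrib
          scaleR_add_right matrix_vector_mult_scaleR)
    moreover have "v ` ?J \<subseteq> right_singular_space ?Z s"
    proof clarify
      fix k assume k: "k \<in> K" "s = d k"
      have "(\<Sum>i\<in>K. ((d i)\<^sup>2 * (v i \<bullet> v k)) *\<^sub>R v i) = (\<Sum>i\<in>K. if k = i then (d i)\<^sup>2 *\<^sub>R v i else 0)"
        by (intro sum.cong refl) (simp add: orthonormal_familyD[OF vo _ k(1)])
      also have "\<dots> = (d k)\<^sup>2 *\<^sub>R v k"
        using K k by simp
      finally show "v k \<in> right_singular_space ?Z (d k)"
        by (simp only: right_singular_space_def mem_Collect_eq gram)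
    qed
    ultimately show "x \<in> right_singular_space ?Z s"
      using span_minimal by blast
  qed
qed

text \<open>By the preceding lemma the multiplicity of a positive singular value \<open>s\<close> is
  the number of indices with \<open>d k = s\<close>. Grouping the sum of the \<open>d k\<close> by
  value then reproduces the definition of the nuclear norm, and zero contributes nothing on either
  side.\<close>

lemma nuclear_norm_sum_outer_prod:
  fixes u :: "'k \<Rightarrow> real ^ 'm" and v :: "'k \<Rightarrow> real ^ 'n"
  assumes uo: "orthonormal_family K u" and vo: "orthonormal_family K v" and K: "finite K"
    and d: "\<And>k. k \<in> K \<Longrightarrow> 0 \<le> d k"
  shows "nuclear_norm (\<Sum>k\<in>K. d k *\<^sub>R outer_prod (u k) (v k)) = (\<Sum>k\<in>K. d k)"
    (is "nuclear_norm ?Z = _")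
proof -
  have dim: "dim (right_singular_space ?Z s) = card {k \<in> K. d k = s}" if "0 < s" for s
  proof -
    have "right_singular_space ?Z s = span (v ` {k \<in> K. d k = s})"
      using d that by (intro right_singular_space_sum_outer_prod[OF uo vo K])
    then show ?thesis
      by (simp only:) (intro orthonormal_family_dim_span orthonormal_family_subset[OF vo], auto)
  qed
  \<comment> \<open>Zero must be removed: with fewer than \<open>CARD('n)\<close> indices it is a
    singular value even if every \<open>d k\<close> is positive.\<close>
  have pos: "singular_values ?Z - {0} = d ` K - {0}"
  proof -
    have mem: "s \<in> singular_values ?Z \<longleftrightarrow> s \<in> d ` K" if s: "0 < s" for s
    proof -
      have "s \<in> singular_values ?Z \<longleftrightarrow> \<not> right_singular_space ?Z s \<subseteq> {0}"
        using s by (auto simp: singular_values_def)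
      also have "\<dots> \<longleftrightarrow> card {k \<in> K. d k = s} \<noteq> 0"
        by (simp only: dim_eq_0[symmetric] dim[OF s])
      also have "\<dots> \<longleftrightarrow> s \<in> d ` K"
        using K by auto
      finally show ?thesis .
    qed
    have nonneg: "0 \<le> s" if "s \<in> singular_values ?Z \<union> d ` K" for s
      using that d by (auto simp: singular_values_def)
    have "s \<in> singular_values ?Z - {0} \<longleftrightarrow> s \<in> d ` K - {0}" for s
      using mem[of s] nonneg[of s] by (cases s "0::real" rule: linorder_cases) auto
    then show ?thesis
      by blast
  qed
  have "nuclear_norm ?Z =
      (\<Sum>s\<in>singular_values ?Z - {0}. real (dim (right_singular_space ?Z s)) * s)"
    unfolding nuclear_norm_def
    by (intro sum.mono_neutral_right) (auto simp: finite_singular_values)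
  also have "\<dots> = (\<Sum>s\<in>d ` K - {0}. real (card {k \<in> K. d k = s}) * s)"
    unfolding pos using d by (intro sum.cong refl) (auto simp: dim order_less_le)
  also have "\<dots> = (\<Sum>s\<in>d ` K. real (card {k \<in> K. d k = s}) * s)"
    using K by (intro sum.mono_neutral_left) auto
  also have "\<dots> = (\<Sum>s\<in>d ` K. \<Sum>k\<in>{k \<in> K. d k = s}. d k)"
    by (intro sum.cong refl) simp
  also have "\<dots> = (\<Sum>k\<in>K. d k)"
    using K by (rule sum.image_gen[symmetric])
  finally show ?thesis .
qed

section \<open>Comparison of the optimization problems\<close>

lemma P1'_feasible_iff:
  fixes u :: "nat \<Rightarrow> real ^ 'm" and v :: "nat \<Rightarrow> real ^ 'n"
  defines "K \<equiv> {1..min CARD('m) CARD('n)}"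
  shows "P1'_feasible (d, u, v) \<longleftrightarrow>
    (\<forall>k\<in>K. 0 \<le> d k) \<and> orthonormal_family K u \<and> orthonormal_family K v"
  unfolding K_def orthonormal_family_iff P1'_feasible.simps by blast

lemma P1'_feasible_imp_P2_feasible: "P1'_feasible p \<Longrightarrow> P2_feasible p"
  by (cases p) auto

lemma svd_exists:
  fixes Z :: "real ^ 'n ^ 'm"
  obtains d u v where "P1'_feasible (d, u, v)" "Z = factor_sum (d, u, v)"
proof -
  let ?K = "{1..min CARD('m) CARD('n)}"
  obtain d u v where st: "singular_triples Z ?K d u v"
    using singular_triples_exist[of ?K Z] by auto
  show ?thesis
  proof
    show "P1'_feasible (d, u, v)"
      using st by (simp add: P1'_feasible_iff singular_triples_def del: P1'_feasible.simps)
    show "Z = factor_sum (d, u, v)"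
      using singular_triples_decomposition[OF st] by simp
  qed
qed

lemma nuclear_norm_svd:
  fixes u :: "nat \<Rightarrow> real ^ 'm" and v :: "nat \<Rightarrow> real ^ 'n"
  assumes "P1'_feasible (d, u, v)"
  shows "nuclear_norm (factor_sum (d, u, v)) = (\<Sum>k = 1..min CARD('m) CARD('n). d k)"
  using assms unfolding P1'_feasible_iff factor_sum.simps
  by (intro nuclear_norm_sum_outer_prod) auto

lemma nuclear_norm_factor_sum_le:
  fixes a :: "nat \<Rightarrow> real ^ 'm" and b :: "nat \<Rightarrow> real ^ 'n"
  assumes feas: "P2_feasible (c, a, b)"
  shows "nuclear_norm (factor_sum (c, a, b)) \<le> (\<Sum>k = 1..min CARD('m) CARD('n). c k)"
proof -
  define K where "K = {1..min CARD('m) CARD('n)}"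
  define Z where "Z = factor_sum (c, a, b)"
  \<comment> \<open>Two representations of one matrix are now available: the given one in
    \<open>Z_def\<close> and an orthonormal one in \<open>Z\<close>. The second turns the nuclear
    norm into a sum of values \<open>u k \<bullet> (Z *v v k)\<close>, which the first then
    expands.\<close>
  obtain d u v where svd: "P1'_feasible (d, u, v)" and Z: "Z = factor_sum (d, u, v)"
    by (rule svd_exists)
  have uo: "orthonormal_family K u" and vo: "orthonormal_family K v"
    using svd unfolding P1'_feasible_iff K_def by auto
  have K: "finite K"
    by (simp add: K_def)
  have Zv: "u k \<bullet> (Z *v v k) = d k" if "k \<in> K" for k
  proof -
    have "u k \<bullet> (Z *v v k) = d k * (v k \<bullet> v k)"
      unfolding Z factor_sum.simps sum_outer_prod_mult_vec
      using orthonormal_family_inner_sum[OF uo K that] by (simp add: K_def)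
    then show ?thesis
      using orthonormal_familyD[OF vo that that] by simp
  qed
  have "nuclear_norm Z = (\<Sum>k\<in>K. d k)"
    using nuclear_norm_svd[OF svd] by (simp only: Z K_def)
  also have "\<dots> = (\<Sum>k\<in>K. u k \<bullet> (Z *v v k))"
    by (simp add: Zv)
  also have "\<dots> = (\<Sum>k\<in>K. \<Sum>j\<in>K. c j * ((u k \<bullet> a j) * (v k \<bullet> b j)))"
    unfolding Z_def factor_sum.simps sum_outer_prod_mult_vec inner_sum_right K_def
    by (intro sum.cong refl) (simp add: inner_commute mult_ac)
  also have "\<dots> = (\<Sum>j\<in>K. c j * (\<Sum>k\<in>K. (u k \<bullet> a j) * (v k \<bullet> b j)))"
    by (subst sum.swap) (simp add: sum_distrib_left)
  \<comment> \<open>The factor 1 lets the inner sums be bounded one \<open>j\<close> at a time, with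
    the nonnegative weights \<open>c j\<close> in front.\<close>
  also have "\<dots> \<le> (\<Sum>j\<in>K. c j * 1)"
  proof (intro sum_mono mult_left_mono)
    fix j assume j: "j \<in> K"
    then have "norm (a j) \<le> 1" "norm (b j) \<le> 1"
      using feas by (auto simp: K_def)
    then have "norm (a j) * norm (b j) \<le> 1"
      by (simp add: mult_le_one)
    then show "(\<Sum>k\<in>K. (u k \<bullet> a j) * (v k \<bullet> b j)) \<le> 1"
      using orthonormal_families_inner_bound[OF uo vo K, of "a j" "b j"] by linarith
    show "0 \<le> c j"
      using feas j by (auto simp: K_def)
  qed
  finally show ?thesis
    by (simp add: Z_def K_def)
qed

text \<open>The data terms depend only on \<open>factor_sum p\<close>, so the objectives can differ
  only in the penalty, and orthonormality makes the penalties equal.\<close>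

lemma P2_obj_svd:
  assumes "P1'_feasible p"
  shows "P2_obj \<Omega> X lam \<sigma> p = P1_obj \<Omega> X lam \<sigma> (factor_sum p)"
proof (cases p)
  case (fields d u v)
  then show ?thesis
    using nuclear_norm_svd[of d u v] assms by (simp only: P2_obj.simps P1_obj_def)
qed

lemma P1_obj_factor_sum_le:
  assumes "0 < lam" "P2_feasible p"
  shows "P1_obj \<Omega> X lam \<sigma> (factor_sum p) \<le> P2_obj \<Omega> X lam \<sigma> p"
proof (cases p)
  case (fields c a b)
  then have "lam * nuclear_norm (factor_sum p) \<le> lam * (\<Sum>k = 1..min CARD('a) CARD('b). c k)"
    using nuclear_norm_factor_sum_le[of c a b] assms by (simp del: factor_sum.simps)
  then show ?thesis
    unfolding fields by (simp only: P2_obj.simps P1_obj_def)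
qed

lemma P1_obj_nonneg: "0 < lam \<Longrightarrow> 0 \<le> P1_obj \<Omega> X lam \<sigma> Z"
  by (simp add: P1_obj_def nuclear_norm_nonneg)

theorem theorem1:
  fixes \<Omega> :: "('m::finite \<times> 'n::finite) set"
    and X :: "real ^ 'n ^ 'm"
    and lam \<sigma> s t :: real
  assumes "lam > 0" and "\<sigma>\<^sup>2 > 0"
    and "s = optimal_value (P1_obj \<Omega> X lam \<sigma>) (\<lambda>Z. True)"
    and "t = optimal_value (P2_obj \<Omega> X lam \<sigma>) P2_feasible"
  shows "s = optimal_value (P2_obj \<Omega> X lam \<sigma>) P1'_feasible \<and>
    s = t \<and>
    (\<forall>d \<alpha> \<beta>. is_arg_min (P2_obj \<Omega> X lam \<sigma>) P2_feasible (d, \<alpha>, \<beta>) \<longrightarrow>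
       is_arg_min (P1_obj \<Omega> X lam \<sigma>) (\<lambda>Z. True) (factor_sum (d, \<alpha>, \<beta>))) \<and>
    (\<forall>Z. is_arg_min (P1_obj \<Omega> X lam \<sigma>) (\<lambda>Z. True) Z \<longrightarrow>
       (\<exists>d \<alpha> \<beta>. Z = factor_sum (d, \<alpha>, \<beta>) \<and>
          is_arg_min (P2_obj \<Omega> X lam \<sigma>) P2_feasible (d, \<alpha>, \<beta>)))"
proof (intro conjI allI impI)
  let ?f = "P1_obj \<Omega> X lam \<sigma>" and ?g = "P2_obj \<Omega> X lam \<sigma>"
  note [simp del] = factor_sum.simps P2_obj.simps P2_feasible.simps P1'_feasible.simps
  \<comment> \<open>From here on only two facts link the problems: \<open>svd\<close> lifts every
    matrix to orthonormal factors without changing the objective, and \<open>le\<close> says that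
    passing from factors to their matrix never increases it.\<close>
  have svd: "\<exists>d u v. P1'_feasible (d, u, v) \<and> Z = factor_sum (d, u, v) \<and> ?g (d, u, v) = ?f Z" for Z
    using svd_exists[of Z] P2_obj_svd[of _ \<Omega> X lam \<sigma>] by metis
  have le: "?f (factor_sum p) \<le> ?g p" if "P2_feasible p" for p
    using P1_obj_factor_sum_le[OF assms(1) that] .
  \<comment> \<open>Both problems have the same set of objective values, hence the same
    infimum.\<close>
  have "range ?f = ?g ` {p. P1'_feasible p}"
    using svd P2_obj_svd[of _ \<Omega> X lam \<sigma>] by (auto simp: image_iff) metis+
  then show s: "s = optimal_value ?g P1'_feasible"
    by (simp add: assms(3) optimal_value_def)
  \<comment> \<open>The comparisons of infima below rest on the lower bound 0 and on nonempty
    feasible sets.\<close>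
  have bdd: "bdd_below (range ?f)"
    using P1_obj_nonneg[OF assms(1)] by (intro bdd_belowI[of _ 0]) auto
  have "0 \<le> ?g p" if "P2_feasible p" for p
    using le[OF that] P1_obj_nonneg[OF assms(1), of \<Omega> X \<sigma> "factor_sum p"] by linarith
  then have bdd': "bdd_below (?g ` {p. P2_feasible p})"
    by (intro bdd_belowI[of _ 0]) auto
  have ne: "{p :: ('m, 'n) factors. P1'_feasible p} \<noteq> {}"
    using svd by blast
  have sub: "{p :: ('m, 'n) factors. P1'_feasible p} \<subseteq> {p. P2_feasible p}"
    using P1'_feasible_imp_P2_feasible by blast
  show "s = t"
  proof (rule antisym)
    show "s \<le> t"
      unfolding assms(3,4) optimal_value_def
    proof (rule cInf_mono)
      show "?g ` {p. P2_feasible p} \<noteq> {}"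
        using ne sub by blast
      show "\<exists>a\<in>?f ` {Z. True}. a \<le> b" if "b \<in> ?g ` {p. P2_feasible p}" for b
        using that le by blast
    qed (use bdd in simp)
    \<comment> \<open>With \<open>s\<close> read as the optimal value under orthonormality
      constraints, \<open>t\<close> is an infimum of the same objective over a larger feasible
      set.\<close>
    show "t \<le> s"
      unfolding s assms(4) optimal_value_def
      using ne sub bdd' by (intro cInf_superset_mono) auto
  qed
  show "is_arg_min ?f (\<lambda>Z. True) (factor_sum (d, \<alpha>, \<beta>))"
    if opt: "is_arg_min ?g P2_feasible (d, \<alpha>, \<beta>)" for d \<alpha> \<beta>
    unfolding is_arg_min_linorder
  proof (intro conjI allI impI TrueI)
    \<comment> \<open>An orthonormal lift \<open>p\<close> of the competitor \<open>W\<close> gives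
      the chain \<open>?f (factor_sum (d, \<alpha>, \<beta>)) \<le> ?g (d, \<alpha>, \<beta>) \<le>
      ?g p = ?f W\<close>.\<close>
    fix W
    obtain p where "P1'_feasible p" "?g p = ?f W"
      using svd by blast
    then have "?g (d, \<alpha>, \<beta>) \<le> ?f W"
      using opt P1'_feasible_imp_P2_feasible by (metis is_arg_min_linorder)
    then show "?f (factor_sum (d, \<alpha>, \<beta>)) \<le> ?f W"
      using le[of "(d, \<alpha>, \<beta>)"] opt by (auto simp: is_arg_min_def)
  qed
  show "\<exists>d \<alpha> \<beta>. Z = factor_sum (d, \<alpha>, \<beta>) \<and> is_arg_min ?g P2_feasible (d, \<alpha>, \<beta>)"
    if opt: "is_arg_min ?f (\<lambda>Z. True) Z" for Z
  proof -
    \<comment> \<open>A singular value decomposition of \<open>Z\<close> serves as the optimal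
      factorization: \<open>?g (d, u, v) = ?f Z \<le> ?f (factor_sum q) \<le> ?g q\<close> for every
      feasible \<open>q\<close>.\<close>
    obtain d u v where p: "P1'_feasible (d, u, v)" "Z = factor_sum (d, u, v)" "?g (d, u, v) = ?f Z"
      using svd by blast
    have "?g (d, u, v) \<le> ?g q" if "P2_feasible q" for q
      using opt le[OF that] p(3) by (metis is_arg_min_linorder order_trans)
    then have "is_arg_min ?g P2_feasible (d, u, v)"
      using p(1) P1'_feasible_imp_P2_feasible by (simp add: is_arg_min_linorder)
    then show ?thesis
      using p(2) by blast
  qed
qed

end
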